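(* Let $\gamma>0$ and let $\mathcal Z=\{\bm z\in\mathbb R^d:\bm A\bm z\ge\bm b\}$ be a nonempty bounded polyhedron, with $\bm A\in\mathbb R^{m\times d}$ having rows $\bm a_i^\top$. For a given $\bm y_0\in\mathbb R^d$, let $S_{\bm y_0}=\{i:\bm a_i^\top\bm z^\star_\gamma(\bm y_0)=b_i\}$ denote the indices of constraints active at $\bm z^\star_\gamma(\bm y_0)$ and let $\bm A_{S_{\bm y_0}}$ be the submatrix of $\bm A$ containing only the rows with indices in $S_{\bm y_0}$. Assume that (i) $\bm A_{S_{\bm y_0}}$ has full row rank, and (ii) strict complementarity holds at $\bm z^\star_\gamma(\bm y_0)$, i.e. the unique Karush–Kuhn–Tucker multiplier $\bm\lambda^0$ associated with $\bm z^\star_\gamma(\bm y_0)$ satisfies $\lambda^0_i>0$ for all $i\in S_{\bm y_0}$. Then there exists a neighborhood of $\bm y_0$ on which the active set of $\bm z^\star_\gamma(\cdot)$ is identically $S_{\bm y_0}$ and $\bm z^\star_\gamma(\cdot)$ is affine. In particular, $\bm z^\star_\gamma(\cdot)$ is differentiable at $\bm y_0$, and its Jacobian is $$\nabla\bm z^\star_\gamma(\bm y_0)=\frac1\gamma\Big(\bm A_{S_{\bm y_0}}^\top(\bm A_{S_{\bm y_0}}\bm A_{S_{\bm y_0}}^\top)^{-1}\bm A_{S_{\bm y_0}}-\bm I\Big).$$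
   Context: $\bm z^\star_\gamma(\bm y)$ denotes the unique minimizer of $\bm y^\top\bm z+\frac{\gamma}{2}\|\bm z\|_2^2$ over $\bm z\in\mathcal Z$. A KKT multiplier at $\bm y_0$ is a vector $\bm\lambda\in\mathbb R^m$, $\bm\lambda\ge\bm 0$, with $\bm y_0+\gamma\bm z^\star_\gamma(\bm y_0)-\bm A^\top\bm\lambda=\bm 0$ and $\lambda_i(\bm a_i^\top\bm z^\star_\gamma(\bm y_0)-b_i)=0$ for all $i$. If $S_{\bm y_0}=\emptyset$, the term $\bm A_S^\top(\bm A_S\bm A_S^\top)^{-1}\bm A_S$ is read as $\bm 0$. *)

theory Defs
  imports "HOL-Analysis.Analysis"
begin

text \<open>The dimensions \<open>d\<close> and \<open>m\<close> are the cardinalities of the finite index types \<open>'d\<close> and \<open>'m\<close>.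
  The order on \<open>real ^ 'm\<close> is componentwise, so \<open>b \<le> A *v z\<close> means
  \<open>a\<^sub>i\<^sup>T z \<ge> b\<^sub>i\<close> for all \<open>i\<close>, where \<open>a\<^sub>i = A $ i\<close>.\<close>

definition polyhedron_of :: "real ^ 'd ^ 'm \<Rightarrow> real ^ 'm \<Rightarrow> (real ^ 'd) set" where
  "polyhedron_of A b = {z. b \<le> A *v z}"

definition reg_objective :: "real \<Rightarrow> real ^ 'd \<Rightarrow> real ^ 'd \<Rightarrow> real" where
  "reg_objective \<gamma> y z = y \<bullet> z + \<gamma> / 2 * (norm z)\<^sup>2"

definition zstar :: "real \<Rightarrow> real ^ 'd ^ 'm \<Rightarrow> real ^ 'm \<Rightarrow> real ^ 'd \<Rightarrow> real ^ 'd" where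
  "zstar \<gamma> A b y = (THE z. is_arg_min (reg_objective \<gamma> y) (\<lambda>w. w \<in> polyhedron_of A b) z)"

definition active_set :: "real \<Rightarrow> real ^ 'd ^ 'm \<Rightarrow> real ^ 'm \<Rightarrow> real ^ 'd \<Rightarrow> 'm set" where
  "active_set \<gamma> A b y = {i. A $ i \<bullet> zstar \<gamma> A b y = b $ i}"

definition kkt_multiplier ::
    "real \<Rightarrow> real ^ 'd ^ 'm \<Rightarrow> real ^ 'm \<Rightarrow> real ^ 'd \<Rightarrow> real ^ 'm \<Rightarrow> bool" where
  "kkt_multiplier \<gamma> A b y \<mu> \<longleftrightarrow>
     0 \<le> \<mu> \<and>
     y + \<gamma> *\<^sub>R zstar \<gamma> A b y - transpose A *v \<mu> = 0 \<and>
     (\<forall>i. \<mu> $ i * (A $ i \<bullet> zstar \<gamma> A b y - b $ i) = 0)"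

text \<open>Since the index set \<open>S\<close> depends on \<open>y\<close> and may be empty, it cannot be an index type.
  A matrix whose rows (or columns) are indexed by \<open>S\<close> is therefore represented by its extension
  by zero to all of \<open>'m\<close>. The unit matrix of the \<open>S \<times> S\<close> matrices is \<open>mat_one_on S\<close>, and
  inverses of \<open>S \<times> S\<close> matrices are taken with respect to it. The lemmas \<open>rank_rows_on\<close>,
  \<open>matrix_inv_on_embed\<close> and \<open>rows_on_projection\<close> compare this with genuine submatrices; \<open>rows_on_empty\<close> is the
  case \<open>S = {}\<close>.\<close>

definition rows_on :: "'m set \<Rightarrow> real ^ 'd ^ 'm \<Rightarrow> real ^ 'd ^ 'm" where
  "rows_on S A = (\<chi> i. if i \<in> S then A $ i else 0)"

definition mat_one_on :: "'m set \<Rightarrow> real ^ 'm ^ 'm" where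
  "mat_one_on S = (\<chi> i j. if i = j \<and> i \<in> S then 1 else 0)"

definition matrix_inv_on :: "'m set \<Rightarrow> real ^ 'm ^ 'm \<Rightarrow> real ^ 'm ^ 'm" where
  "matrix_inv_on S M =
     (THE X. (\<forall>i j. X $ i $ j \<noteq> 0 \<longrightarrow> i \<in> S \<and> j \<in> S) \<and>
             M ** X = mat_one_on S \<and> X ** M = mat_one_on S)"

definition full_row_rank_on :: "'m set \<Rightarrow> real ^ 'd ^ 'm \<Rightarrow> bool" where
  "full_row_rank_on S A \<longleftrightarrow> rank (rows_on S A) = card S"

definition strict_complementarity ::
    "real \<Rightarrow> real ^ 'd ^ 'm \<Rightarrow> real ^ 'm \<Rightarrow> real ^ 'd \<Rightarrow> bool" where
  "strict_complementarity \<gamma> A b y \<longleftrightarrow>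
     (\<forall>i \<in> active_set \<gamma> A b y. 0 < (THE \<mu>. kkt_multiplier \<gamma> A b y \<mu>) $ i)"


subsection \<open>The minimizer is well defined\<close>

lemma ex1_minimizer:
  fixes A :: "real ^ 'd ^ 'm"
  assumes g: "0 < \<gamma>" and ne: "polyhedron_of A b \<noteq> {}" and bd: "bounded (polyhedron_of A b)"
  shows "\<exists>!z. is_arg_min (reg_objective \<gamma> y) (\<lambda>w. w \<in> polyhedron_of A b) z"
proof -
  let ?Z = "polyhedron_of A b"
  let ?f = "reg_objective \<gamma> y"
  have Z: "?Z = (\<Inter>i. {z. A $ i \<bullet> z \<ge> b $ i})"
    by (auto simp: polyhedron_of_def less_eq_vec_def matrix_mult_dot)
  have "closed ?Z"
    unfolding Z by (intro closed_INT ballI closed_halfspace_ge)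
  have cvx: "convex ?Z"
    unfolding Z by (intro convex_INT convex_halfspace_ge)
  from \<open>closed ?Z\<close> bd have "compact ?Z" by (simp add: compact_eq_bounded_closed)
  moreover have "continuous_on ?Z ?f"
    unfolding reg_objective_def by (intro continuous_intros)
  ultimately obtain z where z: "z \<in> ?Z" "\<And>w. w \<in> ?Z \<Longrightarrow> ?f z \<le> ?f w"
    using ne continuous_attains_inf by metis
  have "w = z" if w: "w \<in> ?Z" "?f w \<le> ?f z" for w
  proof (rule ccontr)
    assume "w \<noteq> z"
    define u where "u = (1/2) *\<^sub>R w + (1/2) *\<^sub>R z"
    have "u \<in> ?Z"
      using w(1) z(1) convexD[OF cvx, of w z "1/2" "1/2"] by (simp add: u_def)
    then have "?f z \<le> ?f u" by (rule z(2))
    moreover have "?f u = (?f w + ?f z) / 2 - \<gamma> / 8 * (norm (w - z))\<^sup>2"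
      by (simp add: reg_objective_def u_def power2_norm_eq_inner inner_add_left inner_add_right
          inner_diff_left inner_diff_right inner_commute field_simps)
    moreover have "\<gamma> / 8 * (norm (w - z))\<^sup>2 > 0"
      using g \<open>w \<noteq> z\<close> by simp
    ultimately have "?f u < (?f w + ?f z) / 2" by linarith
    moreover have "(?f w + ?f z) / 2 \<le> ?f z" using w(2) by (simp add: field_simps)
    ultimately show False using \<open>?f z \<le> ?f u\<close> by linarith
  qed
  then show ?thesis
    using z by (intro ex1I[of _ z]) (auto simp: is_arg_min_def not_less)
qed

lemma zstar_minimizer:
  fixes A :: "real ^ 'd ^ 'm"
  assumes "0 < \<gamma>" "polyhedron_of A b \<noteq> {}" "bounded (polyhedron_of A b)"
  shows "is_arg_min (reg_objective \<gamma> y) (\<lambda>w. w \<in> polyhedron_of A b) (zstar \<gamma> A b y)"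
  unfolding zstar_def by (rule theI'[OF ex1_minimizer[OF assms]])


subsection \<open>The multiplier is well defined\<close>

lemma full_row_rank_on_dual:
  fixes A :: "real ^ 'd ^ 'm"
  assumes "full_row_rank_on S A" "i \<in> S"
  obtains d where "A $ i \<bullet> d = 1" "\<And>j. j \<in> S \<Longrightarrow> j \<noteq> i \<Longrightarrow> A $ j \<bullet> d = 0"
proof -
  let ?T = "{x :: real ^ 'm. \<forall>i. i \<notin> S \<longrightarrow> x $ i = 0}"
  let ?R = "range (\<lambda>v. rows_on S A *v v)"
  have "dim ?R = card S"
    using assms(1) by (simp add: full_row_rank_on_def rank_dim_range)
  moreover have "dim ?T = card S"
    using dim_substandard_cart[where 'a=real, of S] by (simp add: dim_vec_eq)
  moreover have "?R \<subseteq> ?T"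
    by (auto simp: rows_on_def matrix_mult_dot)
  moreover have "subspace ?R"
    by (intro linear_subspace_image matrix_vector_mul_linear subspace_UNIV)
  moreover have "subspace ?T"
    by (auto simp: subspace_def)
  ultimately have "?R = ?T"
    by (intro subspace_dim_equal) auto
  moreover have "axis i 1 \<in> ?T"
    using assms(2) by (auto simp: axis_def)
  ultimately obtain d where d: "rows_on S A *v d = axis i 1"
    by (metis (no_types, lifting) imageE)
  have "A $ j \<bullet> d = (if j = i then 1 else 0)" if "j \<in> S" for j
    using arg_cong[OF d, of "\<lambda>v. v $ j"] that
    by (simp add: matrix_mult_dot rows_on_def axis_def)
  with assms(2) show ?thesis by (intro that[of d]) simp_all
qed

lemma first_order_condition:
  fixes A :: "real ^ 'd ^ 'm"
  assumes hyp: "0 < \<gamma>" "polyhedron_of A b \<noteq> {}" "bounded (polyhedron_of A b)"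
    and w: "\<And>i. i \<in> active_set \<gamma> A b y \<Longrightarrow> 0 \<le> A $ i \<bullet> w"
  shows "0 \<le> (y + \<gamma> *\<^sub>R zstar \<gamma> A b y) \<bullet> w"
proof -
  define z where "z = zstar \<gamma> A b y"
  have min: "z \<in> polyhedron_of A b"
      "\<And>u. u \<in> polyhedron_of A b \<Longrightarrow> reg_objective \<gamma> y z \<le> reg_objective \<gamma> y u"
    using zstar_minimizer[OF hyp, of y] by (auto simp: is_arg_min_def z_def not_less)
  have memZ: "u \<in> polyhedron_of A b \<longleftrightarrow> (\<forall>i. b $ i \<le> A $ i \<bullet> u)" for u
    by (simp add: polyhedron_of_def less_eq_vec_def matrix_mult_dot)
  have "\<forall>\<^sub>F t in at_right 0. b $ i \<le> A $ i \<bullet> (z + t *\<^sub>R w)" for i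
  proof (cases "i \<in> active_set \<gamma> A b y")
    case True
    have "\<forall>\<^sub>F t in at_right (0::real). t > 0" by (rule eventually_at_right_less)
    then show ?thesis
      by eventually_elim (use True w[OF True] in \<open>simp add: active_set_def z_def inner_add_right\<close>)
  next
    case False
    then have "b $ i < A $ i \<bullet> z"
      using min(1) by (auto simp: memZ active_set_def z_def less_le)
    moreover have "((\<lambda>t. A $ i \<bullet> (z + t *\<^sub>R w)) \<longlongrightarrow> A $ i \<bullet> (z + 0 *\<^sub>R w)) (at_right 0)"
      by (intro tendsto_intros)
    ultimately have "\<forall>\<^sub>F t in at_right 0. b $ i < A $ i \<bullet> (z + t *\<^sub>R w)"
      by (intro order_tendstoD) auto
    then show ?thesis by eventually_elim simp
  qed
  then have "\<forall>\<^sub>F t in at_right 0. z + t *\<^sub>R w \<in> polyhedron_of A b"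
    unfolding memZ by (rule eventually_all_finite)
  moreover have "\<forall>\<^sub>F t in at_right (0::real). t > 0" by (rule eventually_at_right_less)
  ultimately have "\<forall>\<^sub>F t in at_right 0. 0 \<le> (y + \<gamma> *\<^sub>R z) \<bullet> w + \<gamma> / 2 * t * (norm w)\<^sup>2"
  proof eventually_elim
    case (elim t)
    have "reg_objective \<gamma> y (z + t *\<^sub>R w) - reg_objective \<gamma> y z
        = t * ((y + \<gamma> *\<^sub>R z) \<bullet> w + \<gamma> / 2 * t * (norm w)\<^sup>2)"
      by (simp add: reg_objective_def power2_norm_eq_inner inner_add_left inner_add_right
          inner_commute algebra_simps)
    with min(2)[OF elim(1)] have "0 \<le> t * ((y + \<gamma> *\<^sub>R z) \<bullet> w + \<gamma> / 2 * t * (norm w)\<^sup>2)"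
      by simp
    with elim(2) show ?case by (simp add: zero_le_mult_iff)
  qed
  moreover have "((\<lambda>t. (y + \<gamma> *\<^sub>R z) \<bullet> w + \<gamma> / 2 * t * (norm w)\<^sup>2)
      \<longlongrightarrow> (y + \<gamma> *\<^sub>R z) \<bullet> w + \<gamma> / 2 * 0 * (norm w)\<^sup>2) (at_right 0)"
    by (intro tendsto_intros)
  ultimately have "0 \<le> (y + \<gamma> *\<^sub>R z) \<bullet> w + \<gamma> / 2 * 0 * (norm w)\<^sup>2"
    by (intro tendsto_lowerbound) auto
  then show ?thesis by (simp add: z_def)
qed

lemma ex1_kkt_multiplier:
  fixes A :: "real ^ 'd ^ 'm"
  assumes hyp: "0 < \<gamma>" "polyhedron_of A b \<noteq> {}" "bounded (polyhedron_of A b)"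
    and rk: "full_row_rank_on (active_set \<gamma> A b y) A"
  shows "\<exists>!\<mu>. kkt_multiplier \<gamma> A b y \<mu>"
proof -
  define S where "S = active_set \<gamma> A b y"
  define g where "g = y + \<gamma> *\<^sub>R zstar \<gamma> A b y"
  have "\<exists>d. A $ i \<bullet> d = 1 \<and> (\<forall>j \<in> S. j \<noteq> i \<longrightarrow> A $ j \<bullet> d = 0)" if "i \<in> S" for i
    using full_row_rank_on_dual[OF rk, of i] that unfolding S_def by metis
  then obtain d where d: "\<And>i. i \<in> S \<Longrightarrow> A $ i \<bullet> d i = 1"
      "\<And>i j. i \<in> S \<Longrightarrow> j \<in> S \<Longrightarrow> j \<noteq> i \<Longrightarrow> A $ j \<bullet> d i = 0"
    by metis
  have d': "A $ j \<bullet> d i = (if j = i then 1 else 0)" if "i \<in> S" "j \<in> S" for i j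
    using d that by auto
  have tr: "(transpose A *v l) \<bullet> w = (\<Sum>i\<in>UNIV. l $ i * (A $ i \<bullet> w))" for l w
  proof -
    have "(transpose A *v l) \<bullet> w = l \<bullet> (A *v w)"
      by (metis dot_lmul_matrix inner_commute transpose_matrix_vector)
    then show ?thesis by (simp add: inner_vec_def[of l] matrix_mult_dot)
  qed
  have foc: "0 \<le> g \<bullet> w" if "\<And>i. i \<in> S \<Longrightarrow> 0 \<le> A $ i \<bullet> w" for w
    using first_order_condition[OF hyp, of y w] that by (auto simp: g_def S_def)
  define l where "l = (\<chi> i. if i \<in> S then g \<bullet> d i else 0)"
  have "0 \<le> g \<bullet> d i" if "i \<in> S" for i
    by (rule foc) (simp add: d' that)
  then have "0 \<le> l" by (simp add: l_def less_eq_vec_def)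
  moreover have "g - transpose A *v l = 0"
  proof -
    have "g \<bullet> w = (transpose A *v l) \<bullet> w" for w
    proof -
      define v where "v = w - (\<Sum>i\<in>S. (A $ i \<bullet> w) *\<^sub>R d i)"
      have v0: "A $ j \<bullet> v = 0" if "j \<in> S" for j
      proof -
        have "(\<Sum>i\<in>S. (A $ i \<bullet> w) * (A $ j \<bullet> d i)) = (\<Sum>i\<in>S. if i = j then A $ j \<bullet> w else 0)"
          by (rule sum.cong) (use that d' in auto)
        also have "\<dots> = A $ j \<bullet> w" using that by (simp add: sum.delta)
        finally show ?thesis by (simp add: v_def inner_diff_right inner_sum_right)
      qed
      have "0 \<le> g \<bullet> v" by (rule foc) (simp add: v0)
      moreover have "0 \<le> g \<bullet> (- v)" by (rule foc) (simp add: v0)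
      ultimately have "g \<bullet> v = 0" by simp
      then have "g \<bullet> w = (\<Sum>i\<in>S. (A $ i \<bullet> w) * (g \<bullet> d i))"
        by (simp add: v_def inner_diff_right inner_sum_right)
      also have "\<dots> = (\<Sum>i\<in>UNIV. l $ i * (A $ i \<bullet> w))"
        by (rule sum.mono_neutral_cong_left) (auto simp: l_def)
      finally show ?thesis by (simp only: tr)
    qed
    then have "g = transpose A *v l" using vector_eq_rdot by blast
    then show ?thesis by simp
  qed
  moreover have "\<forall>i. l $ i * (A $ i \<bullet> zstar \<gamma> A b y - b $ i) = 0"
    by (auto simp: l_def S_def active_set_def)
  ultimately have ex: "kkt_multiplier \<gamma> A b y l"
    by (simp add: kkt_multiplier_def g_def)
  have supp: "k $ i = g \<bullet> d i" if k: "kkt_multiplier \<gamma> A b y k" and i: "i \<in> S" for k i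
  proof -
    have k0: "k $ j = 0" if "j \<notin> S" for j
      using k that by (auto simp: kkt_multiplier_def S_def active_set_def)
    have "g \<bullet> d i = (transpose A *v k) \<bullet> d i"
      using k by (simp add: kkt_multiplier_def g_def)
    also have "\<dots> = (\<Sum>j\<in>UNIV. if j = i then k $ i else 0)"
      unfolding tr
    proof (rule sum.cong)
      show "k $ j * (A $ j \<bullet> d i) = (if j = i then k $ i else 0)" for j
        by (cases "j \<in> S") (use k0 i d' in auto)
    qed simp
    also have "\<dots> = k $ i" by simp
    finally show ?thesis by simp
  qed
  have "k = l" if k: "kkt_multiplier \<gamma> A b y k" for k
  proof -
    have "k $ j = 0" if "j \<notin> S" for j
      using k that by (auto simp: kkt_multiplier_def S_def active_set_def)
    with supp[OF k] show ?thesis by (auto simp: vec_eq_iff l_def)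
  qed
  with ex show ?thesis by blast
qed


subsection \<open>Comparison with genuine submatrices\<close>

text \<open>Let \<open>f\<close> enumerate \<open>S\<close> by a type \<open>'s\<close>, so that the submatrix with row indices in \<open>S\<close> is
  the matrix with rows \<open>A $ f j\<close>.\<close>

definition embed_mat :: "('s \<Rightarrow> 'm) \<Rightarrow> real ^ 's ^ 'm" where
  "embed_mat f = (\<chi> i j. if f j = i then 1 else 0)"

lemma embed_mat_left: "inj f \<Longrightarrow> transpose (embed_mat f) ** embed_mat f = mat 1"
  by (auto simp: vec_eq_iff embed_mat_def transpose_def matrix_matrix_mult_def mat_def inj_eq
      if_distrib[of "\<lambda>x. x * _"] cong: if_cong)

lemma embed_mat_right:
  fixes f :: "'s::finite \<Rightarrow> 'm::finite"
  assumes "inj f"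
  shows "embed_mat f ** transpose (embed_mat f) = mat_one_on (range f)"
proof -
  have "(\<Sum>k\<in>UNIV. (if f k = i then 1 else 0) * (if f k = j then 1 else 0))
      = (if i = j \<and> i \<in> range f then 1 else (0::real))" for i j
  proof (cases "i \<in> range f")
    case True
    then obtain a where a: "i = f a" by auto
    have "(\<Sum>k\<in>UNIV. (if f k = i then 1 else 0) * (if f k = j then 1 else 0))
        = (\<Sum>k\<in>UNIV. if k = a then (if i = j then 1 else 0) else (0::real))"
      by (rule sum.cong) (use a assms in \<open>auto simp: inj_eq\<close>)
    then show ?thesis using True by simp
  next
    case False
    then have "f k \<noteq> i" for k by auto
    with False show ?thesis by simp
  qed
  then show ?thesis
    by (simp add: vec_eq_iff embed_mat_def transpose_def matrix_matrix_mult_def mat_one_on_def)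
qed

lemma rows_on_embed:
  fixes f :: "'s::finite \<Rightarrow> 'm::finite" and A :: "real ^ 'd ^ 'm"
  assumes "inj f"
  shows "rows_on (range f) A = embed_mat f ** (\<chi> j. A $ f j)"
proof -
  have "(\<Sum>k\<in>UNIV. (if f k = i then 1 else 0) * A $ f k $ c)
      = (if i \<in> range f then A $ i else 0) $ c" for i c
  proof (cases "i \<in> range f")
    case True
    then obtain a where a: "i = f a" by auto
    have "(\<Sum>k\<in>UNIV. (if f k = i then 1 else 0) * A $ f k $ c)
        = (\<Sum>k\<in>UNIV. if k = a then A $ i $ c else 0)"
      by (rule sum.cong) (use a assms in \<open>auto simp: inj_eq\<close>)
    then show ?thesis using True by simp
  next
    case False
    then have "f k \<noteq> i" for k by auto
    with False show ?thesis by simp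
  qed
  then show ?thesis
    by (simp add: vec_eq_iff embed_mat_def matrix_matrix_mult_def rows_on_def)
qed

lemma rank_rows_on:
  fixes f :: "'s::finite \<Rightarrow> 'm::finite" and A :: "real ^ 'd ^ 'm"
  assumes "inj f"
  shows "rank (rows_on (range f) A) = rank (\<chi> j. A $ f j)"
proof (rule antisym)
  let ?B = "\<chi> j. A $ f j"
  show "rank (rows_on (range f) A) \<le> rank ?B"
    unfolding rows_on_embed[OF assms] by (rule rank_mul_le_right)
  have "?B = transpose (embed_mat f) ** (embed_mat f ** ?B)"
    by (simp add: matrix_mul_assoc embed_mat_left[OF assms])
  then show "rank ?B \<le> rank (rows_on (range f) A)"
    unfolding rows_on_embed[OF assms] by (metis rank_mul_le_right)
qed

lemma mat_one_on_mult_left: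
  assumes "\<forall>i j. X $ i $ j \<noteq> 0 \<longrightarrow> i \<in> S \<and> j \<in> S"
  shows "mat_one_on S ** X = X"
proof -
  have "(\<Sum>k\<in>UNIV. (if i = k \<and> i \<in> S then 1 else 0) * X $ k $ j) = X $ i $ j" for i j
  proof -
    have "(\<Sum>k\<in>UNIV. (if i = k \<and> i \<in> S then 1 else 0) * X $ k $ j)
        = (\<Sum>k\<in>UNIV. if k = i then X $ i $ j else 0)"
      by (rule sum.cong) (use assms in auto)
    then show ?thesis by simp
  qed
  then show ?thesis
    by (simp add: vec_eq_iff matrix_matrix_mult_def mat_one_on_def)
qed

lemma mat_one_on_mult_right:
  assumes "\<forall>i j. X $ i $ j \<noteq> 0 \<longrightarrow> i \<in> S \<and> j \<in> S"
  shows "X ** mat_one_on S = X"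
proof -
  have "(\<Sum>k\<in>UNIV. X $ i $ k * (if k = j \<and> k \<in> S then 1 else 0)) = X $ i $ j" for i j
  proof -
    have "(\<Sum>k\<in>UNIV. X $ i $ k * (if k = j \<and> k \<in> S then 1 else 0))
        = (\<Sum>k\<in>UNIV. if k = j then X $ i $ j else 0)"
      by (rule sum.cong) (use assms in auto)
    then show ?thesis by simp
  qed
  then show ?thesis
    by (simp add: vec_eq_iff matrix_matrix_mult_def mat_one_on_def)
qed

lemma matrix_inv_on_eqI:
  assumes "\<forall>i j. X $ i $ j \<noteq> 0 \<longrightarrow> i \<in> S \<and> j \<in> S"
    and "M ** X = mat_one_on S" "X ** M = mat_one_on S"
  shows "matrix_inv_on S M = X"
  unfolding matrix_inv_on_def
proof (rule the_equality)
  fix Y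
  assume Y: "(\<forall>i j. Y $ i $ j \<noteq> 0 \<longrightarrow> i \<in> S \<and> j \<in> S) \<and>
    M ** Y = mat_one_on S \<and> Y ** M = mat_one_on S"
  have "Y = Y ** (M ** X)" using Y assms by (simp add: mat_one_on_mult_right)
  also have "\<dots> = (Y ** M) ** X" by (rule matrix_mul_assoc)
  also have "\<dots> = X" using Y assms by (simp add: mat_one_on_mult_left)
  finally show "Y = X" .
qed (use assms in auto)

lemma matrix_inv_on_embed:
  fixes f :: "'s::finite \<Rightarrow> 'm::finite" and M :: "real ^ 's ^ 's"
  assumes f: "inj f" and M: "invertible M"
  shows "matrix_inv_on (range f) (embed_mat f ** M ** transpose (embed_mat f))
       = embed_mat f ** matrix_inv M ** transpose (embed_mat f)"
proof (rule matrix_inv_on_eqI)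
  let ?P = "embed_mat f"
  have c: "?P ** K ** transpose ?P ** (?P ** L ** transpose ?P) = ?P ** (K ** L) ** transpose ?P"
    for K L :: "real ^ 's ^ 's"
    by (metis embed_mat_left[OF f] matrix_mul_assoc matrix_mul_rid)
  have i: "M ** matrix_inv M = mat 1" "matrix_inv M ** M = mat 1"
    using M by (auto simp: invertible_def matrix_inv_def intro: someI2_ex)
  show "?P ** M ** transpose ?P ** (?P ** matrix_inv M ** transpose ?P) = mat_one_on (range f)"
    "?P ** matrix_inv M ** transpose ?P ** (?P ** M ** transpose ?P) = mat_one_on (range f)"
    by (simp_all add: c i embed_mat_right[OF f])
  have "(?P ** matrix_inv M ** transpose ?P) $ i $ j = 0" if "i \<notin> range f \<or> j \<notin> range f" for i j
  proof -
    have "?P $ i = 0 \<or> ?P $ j = 0"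
      using that by (auto simp: vec_eq_iff embed_mat_def)
    then show ?thesis
      by (auto simp: matrix_matrix_mult_def transpose_def)
  qed
  then show "\<forall>i j. (?P ** matrix_inv M ** transpose ?P) $ i $ j \<noteq> 0 \<longrightarrow> i \<in> range f \<and> j \<in> range f"
    by blast
qed

lemma rows_on_projection:
  fixes f :: "'s::finite \<Rightarrow> 'm::finite" and A :: "real ^ 'd ^ 'm"
  defines "B \<equiv> \<chi> j. A $ f j"
  assumes f: "inj f" and inv: "invertible (B ** transpose B)"
  shows "transpose (rows_on (range f) A) **
           matrix_inv_on (range f) (rows_on (range f) A ** transpose (rows_on (range f) A)) **
           rows_on (range f) A
       = transpose B ** matrix_inv (B ** transpose B) ** B"
proof -
  let ?P = "embed_mat f"
  have R: "rows_on (range f) A = ?P ** B"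
    unfolding B_def by (rule rows_on_embed[OF f])
  have "?P ** B ** transpose (?P ** B) = ?P ** (B ** transpose B) ** transpose ?P"
    by (simp add: matrix_transpose_mul matrix_mul_assoc)
  then have "matrix_inv_on (range f) (?P ** B ** transpose (?P ** B))
      = ?P ** matrix_inv (B ** transpose B) ** transpose ?P"
    by (simp add: matrix_inv_on_embed[OF f inv])
  then have "transpose (rows_on (range f) A) **
      matrix_inv_on (range f) (rows_on (range f) A ** transpose (rows_on (range f) A)) **
      rows_on (range f) A
    = transpose B ** (transpose ?P ** ?P) ** matrix_inv (B ** transpose B) ** (transpose ?P ** ?P) ** B"
    by (simp add: R matrix_transpose_mul matrix_mul_assoc)
  then show ?thesis by (simp add: embed_mat_left[OF f])
qed

lemma rows_on_empty: "transpose (rows_on {} A) ** X ** rows_on {} A = 0"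
  by (simp add: rows_on_def vec_eq_iff matrix_matrix_mult_def)

end

theory Submission
  imports Defs
begin

text \<open>Moving the minimizer and its multiplier affinely so that stationarity and the active
  equations persist gives
  \<open>z(y) = z\<^sub>0 + (E - I) (y - y\<^sub>0) / \<gamma>\<close> and \<open>\<lambda>(y) = \<lambda>\<^sub>0 + X A\<^sub>S (y - y\<^sub>0)\<close>, where
  \<open>X = (A\<^sub>S A\<^sub>S\<^sup>T)\<^sup>-\<^sup>1\<close> and \<open>E = A\<^sub>S\<^sup>T X A\<^sub>S\<close>. Strict complementarity and strict
  feasibility of the inactive constraints are open conditions, so near \<open>y\<^sub>0\<close> the pair satisfies
  the KKT conditions, which are sufficient by convexity.\<close>

section \<open>Matrix identities and sufficiency of the KKT conditions\<close>

lemma inner_transpose_mult: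
  fixes A :: "real ^ 'd ^ 'm"
  shows "(transpose A *v l) \<bullet> w = l \<bullet> (A *v w)"
  by (metis dot_lmul_matrix inner_commute transpose_matrix_vector)

lemma matrix_diff_ldistrib:
  fixes A :: "'a::ring_1 ^ 'n ^ 'm"
  shows "A ** (B - C) = A ** B - A ** C"
  by (simp add: vec_eq_iff matrix_matrix_mult_def right_diff_distrib sum_subtractf)

lemma matrix_diff_rdistrib:
  fixes A :: "'a::ring_1 ^ 'n ^ 'm"
  shows "(A - B) ** C = A ** C - B ** C"
  by (simp add: vec_eq_iff matrix_matrix_mult_def left_diff_distrib sum_subtractf)

lemma matrix_add_rdistrib:
  fixes A :: "'a::semiring_1 ^ 'n ^ 'm"
  shows "(A + B) ** C = A ** C + B ** C"
  by (simp add: vec_eq_iff matrix_matrix_mult_def distrib_right sum.distrib)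

text \<open>The objective is quadratic, so its gap between \<open>u\<close> and \<open>z\<close> is
  exactly the gradient term \<open>(y + \<gamma> *\<^sub>R z) \<bullet> (u - z)\<close> plus a
  nonnegative square. By stationarity the gradient term is
  \<open>l \<bullet> (A *v (u - z))\<close>, and complementarity replaces
  \<open>A $ i \<bullet> z\<close> by \<open>b $ i\<close> in it, which leaves a sum of nonnegative
  terms.\<close>

lemma zstar_eqI_kkt:
  fixes A :: "real ^ 'd ^ 'm"
  assumes g: "0 < \<gamma>" and feas: "b \<le> A *v z" and l: "0 \<le> l"
    and stat: "y + \<gamma> *\<^sub>R z = transpose A *v l"
    and comp: "\<And>i. l $ i * (A $ i \<bullet> z - b $ i) = 0"
    and bd: "bounded (polyhedron_of A b)"
  shows "zstar \<gamma> A b y = z"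
proof -
  have zZ: "z \<in> polyhedron_of A b"
    using feas by (simp add: polyhedron_of_def)
  have "reg_objective \<gamma> y z \<le> reg_objective \<gamma> y u" if u: "u \<in> polyhedron_of A b" for u
  proof -
    have "l \<bullet> (A *v (u - z)) = (\<Sum>i\<in>UNIV. l $ i * (A $ i \<bullet> u - b $ i))"
      unfolding inner_vec_def[of l]
    proof (rule sum.cong)
      show "l $ i \<bullet> (A *v (u - z)) $ i = l $ i * (A $ i \<bullet> u - b $ i)" for i
        using comp[of i] by (simp add: matrix_mult_dot inner_diff_right right_diff_distrib)
    qed simp
    moreover have "0 \<le> \<dots>"
      using l u by (intro sum_nonneg mult_nonneg_nonneg)
        (simp_all add: less_eq_vec_def polyhedron_of_def matrix_mult_dot)
    ultimately have "0 \<le> (y + \<gamma> *\<^sub>R z) \<bullet> (u - z)"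
      unfolding stat inner_transpose_mult by simp
    moreover have "reg_objective \<gamma> y u - reg_objective \<gamma> y z
        = (y + \<gamma> *\<^sub>R z) \<bullet> (u - z) + \<gamma> / 2 * (norm (u - z))\<^sup>2"
      by (simp add: reg_objective_def power2_norm_eq_inner inner_add_left inner_add_right
          inner_diff_left inner_diff_right inner_commute field_simps)
    moreover have "0 \<le> \<gamma> / 2 * (norm (u - z))\<^sup>2"
      using g by simp
    ultimately show ?thesis by linarith
  qed
  then have "is_arg_min (reg_objective \<gamma> y) (\<lambda>w. w \<in> polyhedron_of A b) z"
    using zZ by (auto simp: is_arg_min_def not_less)
  moreover have "polyhedron_of A b \<noteq> {}"
    using zZ by blast
  ultimately show ?thesis
    using ex1_minimizer[OF g _ bd, of y] zstar_minimizer[OF g _ bd, of y] by blast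
qed

section \<open>Inverting the Gram matrix of the selected rows\<close>

lemma mat_one_on_mult_vec: "(mat_one_on S *v v) $ i = (if i \<in> S then v $ i else 0)"
proof -
  have "(mat_one_on S *v v) $ i = (\<Sum>j\<in>UNIV. if j = i then (if i \<in> S then v $ i else 0) else 0)"
    unfolding matrix_vector_mult_def mat_one_on_def vec_lambda_beta
    by (rule sum.cong) auto
  then show ?thesis by simp
qed

lemma mat_one_on_mult_rows_on: "mat_one_on S ** rows_on S A = rows_on S A"
proof -
  have "(mat_one_on S ** rows_on S A) *v v = rows_on S A *v v" for v
    by (simp add: vec_eq_iff matrix_vector_mul_assoc[symmetric] mat_one_on_mult_vec)
      (simp add: matrix_mult_dot rows_on_def)
  then show ?thesis by (simp add: matrix_eq)
qed

lemma transpose_mat_one_on: "transpose (mat_one_on S) = mat_one_on S"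
  by (auto simp: vec_eq_iff transpose_def mat_one_on_def)

text \<open>Pairing \<open>v\<close> with the image of a direction \<open>d\<close> dual to row
  \<open>i\<close> isolates \<open>v $ i\<close>. Entries outside \<open>S\<close> only meet zero
  rows, so they have to vanish by assumption.\<close>

lemma full_row_rank_on_inj:
  fixes A :: "real ^ 'd ^ 'm"
  assumes rk: "full_row_rank_on S A" and v: "\<And>i. i \<notin> S \<Longrightarrow> v $ i = 0"
    and 0: "transpose (rows_on S A) *v v = 0"
  shows "v = 0"
proof -
  have "v $ i = 0" if i: "i \<in> S" for i
  proof -
    obtain d where d: "A $ i \<bullet> d = 1" "\<And>j. j \<in> S \<Longrightarrow> j \<noteq> i \<Longrightarrow> A $ j \<bullet> d = 0"
      using full_row_rank_on_dual[OF rk i] by blast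
    have "0 = v \<bullet> (rows_on S A *v d)"
      by (metis 0 inner_transpose_mult inner_zero_left)
    also have "rows_on S A *v d = axis i 1"
      using d i by (auto simp: vec_eq_iff matrix_mult_dot rows_on_def axis_def)
    finally show ?thesis by (simp add: inner_axis)
  qed
  with v show ?thesis by (auto simp: vec_eq_iff)
qed

text \<open>The Gram matrix \<open>A\<^sub>S A\<^sub>S\<^sup>T\<close>, completed by the identity on the complement of \<open>S\<close>, is positive
  definite and commutes with \<open>mat_one_on S\<close>; cutting its inverse down to \<open>S\<close> gives the inverse
  relative to \<open>mat_one_on S\<close>.\<close>

lemma matrix_inv_on_gram:
  fixes A :: "real ^ 'd ^ 'm"
  assumes rk: "full_row_rank_on S A"
  defines "G \<equiv> rows_on S A ** transpose (rows_on S A)"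
  shows "\<forall>i j. matrix_inv_on S G $ i $ j \<noteq> 0 \<longrightarrow> i \<in> S \<and> j \<in> S"
    and "G ** matrix_inv_on S G = mat_one_on S"
proof -
  define P where "P = mat_one_on S"
  define N where "N = G + (mat 1 - P)"
  have PG: "P ** G = G"
    by (simp add: G_def P_def matrix_mul_assoc mat_one_on_mult_rows_on)
  have GP: "G ** P = G"
    using PG by (metis G_def P_def matrix_transpose_mul transpose_mat_one_on transpose_transpose)
  have PP: "P ** P = P"
    unfolding P_def by (rule mat_one_on_mult_left) (auto simp: mat_one_on_def)
  have PN: "P ** N = G"
    by (simp add: N_def matrix_add_ldistrib matrix_diff_ldistrib PG PP)
  have NP: "N ** P = G"
    by (simp add: N_def matrix_add_rdistrib matrix_diff_rdistrib GP PP)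
  \<comment> \<open>The quadratic form of \<open>N\<close> is a sum of two squares because
    \<open>mat 1 - P\<close> is an orthogonal projection. If both vanish, the second puts the
    support of \<open>v\<close> inside \<open>S\<close>, and full row rank then applies to the
    first.\<close>
  have "v = 0" if v: "N *v v = 0" for v
  proof -
    have "v \<bullet> (G *v v) = (norm (transpose (rows_on S A) *v v))\<^sup>2"
      by (simp add: G_def matrix_vector_mul_assoc[symmetric] inner_transpose_mult[symmetric]
          power2_norm_eq_inner)
    moreover have "v \<bullet> ((mat 1 - P) *v v) = (norm ((mat 1 - P) *v v))\<^sup>2"
      unfolding power2_norm_eq_inner inner_vec_def[where 'b='m]
      by (rule sum.cong) (simp_all add: matrix_vector_mult_diff_rdistrib P_def mat_one_on_mult_vec)
    ultimately have "(norm (transpose (rows_on S A) *v v))\<^sup>2 + (norm ((mat 1 - P) *v v))\<^sup>2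
        = v \<bullet> (N *v v)"
      by (simp add: N_def matrix_vector_mult_add_rdistrib inner_add_right)
    then have *: "transpose (rows_on S A) *v v = 0" "(mat 1 - P) *v v = 0"
      using v by (simp_all add: add_nonneg_eq_0_iff)
    have "v $ i = 0" if "i \<notin> S" for i
      using arg_cong[OF *(2), of "\<lambda>w. w $ i"] that
      by (simp add: matrix_vector_mult_diff_rdistrib P_def mat_one_on_mult_vec)
    from full_row_rank_on_inj[OF rk this *(1)] show ?thesis .
  qed
  then obtain K where KN: "K ** N = mat 1"
    using matrix_left_invertible_ker[of N] by blast
  then have NK: "N ** K = mat 1"
    by (simp add: matrix_left_right_inverse)
  \<comment> \<open>\<open>K\<close> inherits commutation with \<open>P\<close> from its inverse
    \<open>N\<close>, as both products of \<open>N\<close> and \<open>P\<close> equal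
    \<open>G\<close>.\<close>
  have KP: "K ** P = P ** K"
  proof -
    have "K ** P = K ** (P ** N) ** K"
      by (metis NK matrix_mul_assoc matrix_mul_rid)
    also have "\<dots> = K ** (N ** P) ** K" by (simp only: PN NP)
    also have "\<dots> = P ** K" by (simp add: matrix_mul_assoc KN)
    finally show ?thesis .
  qed
  have "G ** (P ** K) = P ** (N ** K)"
    by (metis GP PN matrix_mul_assoc)
  then have GX: "G ** (P ** K) = P" by (simp add: NK)
  have XG: "P ** K ** G = P"
    by (metis KN KP NP PG PN PP matrix_mul_assoc matrix_mul_lid matrix_mul_rid)
  \<comment> \<open>The left factor \<open>P\<close> clears the rows outside \<open>S\<close>, and a
    right factor \<open>P\<close> clears the columns; by \<open>KP\<close> one matrix has both
    properties.\<close>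
  have "(P ** K) $ i $ j = 0" if "i \<notin> S" for i j
    using that by (simp add: P_def mat_one_on_def matrix_matrix_mult_def)
  moreover have "(K ** P) $ i $ j = 0" if "j \<notin> S" for i j
    using that by (auto simp: P_def mat_one_on_def matrix_matrix_mult_def intro!: sum.neutral)
  ultimately have X: "\<forall>i j. (P ** K) $ i $ j \<noteq> 0 \<longrightarrow> i \<in> S \<and> j \<in> S"
    unfolding KP by blast
  have "matrix_inv_on S G = P ** K"
    using X GX XG unfolding P_def by (rule matrix_inv_on_eqI)
  with X GX show "\<forall>i j. matrix_inv_on S G $ i $ j \<noteq> 0 \<longrightarrow> i \<in> S \<and> j \<in> S"
    and "G ** matrix_inv_on S G = mat_one_on S"
    by (simp_all add: P_def)
qed

text \<open>This turns the stationarity equation for the active rows into the one for all of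
  \<open>A\<close>.\<close>

lemma transpose_rows_on_mult_vec:
  assumes "\<And>i. i \<notin> S \<Longrightarrow> v $ i = 0"
  shows "transpose (rows_on S A) *v v = transpose A *v v"
  using assms
  by (auto simp: vec_eq_iff matrix_vector_mult_def transpose_def rows_on_def intro!: sum.cong)

section \<open>The affine solution near \<open>y0\<close>\<close>

theorem proposition6:
  fixes \<gamma> :: real and A :: "real ^ 'd ^ 'm" and b :: "real ^ 'm" and y0 :: "real ^ 'd"
    and S :: "'m set" and A_S :: "real ^ 'd ^ 'm"
  defines "S \<equiv> active_set \<gamma> A b y0"
    and "A_S \<equiv> rows_on S A"
  assumes "\<gamma> > 0"
    and "polyhedron_of A b \<noteq> {}"
    and "bounded (polyhedron_of A b)"
    and "full_row_rank_on S A"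
    and "strict_complementarity \<gamma> A b y0"
  shows "(\<exists>U. open U \<and> y0 \<in> U \<and>
            (\<forall>y \<in> U. active_set \<gamma> A b y = S) \<and>
            (\<exists>(M :: real ^ 'd ^ 'd) (c :: real ^ 'd). \<forall>y \<in> U. zstar \<gamma> A b y = M *v y + c))
       \<and> zstar \<gamma> A b differentiable (at y0)
       \<and> jacobian (zstar \<gamma> A b) (at y0) =
           (1 / \<gamma>) *\<^sub>R (transpose A_S ** matrix_inv_on S (A_S ** transpose A_S) ** A_S - mat 1)"
proof -
  note g = assms(3) and ne = assms(4) and bd = assms(5) and rk = assms(6)
  define z0 where "z0 = zstar \<gamma> A b y0"
  define X where "X = matrix_inv_on S (A_S ** transpose A_S)"
  define M where "M = (1 / \<gamma>) *\<^sub>R (transpose A_S ** X ** A_S - mat 1)"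
  \<comment> \<open>Uniqueness ensures that the \<open>THE\<close> in
    \<open>strict_complementarity\<close> denotes an actual multiplier.\<close>
  obtain l0 where l0: "kkt_multiplier \<gamma> A b y0 l0"
    and l0_pos: "\<And>i. i \<in> S \<Longrightarrow> 0 < l0 $ i"
    using theI'[OF ex1_kkt_multiplier[OF g ne bd rk[unfolded S_def]]] assms(7)
    unfolding strict_complementarity_def S_def by blast
  define z where "z = (\<lambda>y. z0 + M *v (y - y0))"
  define l where "l = (\<lambda>y. l0 + X *v (A_S *v (y - y0)))"
  note X = matrix_inv_on_gram[OF rk, folded A_S_def, folded X_def]
  have X_out: "(X *v v) $ i = 0" if "i \<notin> S" for v i
    unfolding matrix_vector_mult_def vec_lambda_beta
    by (rule sum.neutral) (use X(1) that in \<open>metis mult_zero_left\<close>)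
  have l_out: "l y $ i = 0" if "i \<notin> S" for y i
    using l0 that X_out[OF that]
    by (auto simp: l_def kkt_multiplier_def S_def active_set_def)
  \<comment> \<open>When \<open>y\<close> moves by \<open>v\<close> and \<open>z\<close> by
    \<open>M *v v\<close>, the gradient moves by \<open>transpose A\<close> applied to
    \<open>X *v (A_S *v v)\<close>, which is exactly the multiplier shift in
    \<open>l\<close>.\<close>
  have Mv: "\<gamma> *\<^sub>R (M *v v) = transpose A *v (X *v (A_S *v v)) - v" for v
  proof -
    have "\<gamma> *\<^sub>R (M *v v) = (transpose A_S ** X ** A_S) *v v - v"
      using g by (simp add: M_def scaleR_matrix_vector_assoc[symmetric] matrix_vector_mult_diff_rdistrib)
    also have "(transpose A_S ** X ** A_S) *v v = transpose A_S *v (X *v (A_S *v v))"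
      by (simp add: matrix_vector_mul_assoc matrix_mul_assoc)
    also have "\<dots> = transpose A *v (X *v (A_S *v v))"
      unfolding A_S_def by (rule transpose_rows_on_mult_vec) (rule X_out)
    finally show ?thesis .
  qed
  \<comment> \<open>\<open>X\<close> inverts the Gram matrix, so \<open>A_S ** M\<close> cancels and
    moving along \<open>M\<close> keeps the active constraints tight.\<close>
  have AM: "A_S *v (M *v v) = 0" for v
  proof -
    have "A_S ** M = (1 / \<gamma>) *\<^sub>R (A_S ** transpose A_S ** X ** A_S - A_S)"
      by (simp add: M_def matrix_scalar_ac scalar_matrix_assoc[symmetric] matrix_diff_ldistrib matrix_mul_assoc
          scaleR_diff_right)
    also have "\<dots> = 0"
      by (simp add: X(2) mat_one_on_mult_rows_on[of S A, folded A_S_def])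
    finally show ?thesis by (simp add: matrix_vector_mul_assoc)
  qed
  have act: "A $ i \<bullet> z y = b $ i" if "i \<in> S" for i y
  proof -
    have "A $ i \<bullet> (M *v (y - y0)) = 0"
      using arg_cong[OF AM[of "y - y0"], of "\<lambda>v. v $ i"] that
      by (simp add: matrix_mult_dot A_S_def rows_on_def)
    then show ?thesis
      using that by (simp add: z_def z0_def inner_add_right S_def active_set_def)
  qed
  have stat: "y + \<gamma> *\<^sub>R z y = transpose A *v l y" for y
  proof -
    have "y0 + \<gamma> *\<^sub>R z0 = transpose A *v l0"
      using l0 by (simp add: kkt_multiplier_def z0_def)
    then show ?thesis
      by (simp add: z_def l_def scaleR_add_right Mv matrix_vector_right_distrib algebra_simps)
  qed
  \<comment> \<open>The KKT equations hold along \<open>z\<close> and \<open>l\<close> for every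
    \<open>y\<close>; only the inequalities can fail. Their strict forms, positive multipliers on
    \<open>S\<close> and positive slack off \<open>S\<close>, define an open set and also fix the
    active set.\<close>
  define U where "U = {y. \<forall>i. if i \<in> S then 0 < l y $ i else b $ i < A $ i \<bullet> z y}"
  have cont: "continuous_on UNIV z" "continuous_on UNIV l"
    unfolding z_def l_def by (intro continuous_intros
        linear_continuous_on_compose[OF _ matrix_vector_mul_linear])+
  have "open {y. if i \<in> S then 0 < l y $ i else b $ i < A $ i \<bullet> z y}" for i
    by (cases "i \<in> S") (simp_all, (intro open_Collect_less continuous_intros cont)+)
  then have oU: "open U"
    unfolding U_def Collect_all_eq by (intro open_INT) auto
  have y0U: "y0 \<in> U"
  proof -
    have "b \<le> A *v z0"
      using zstar_minimizer[OF g ne bd, of y0]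
      by (simp add: is_arg_min_def polyhedron_of_def z0_def)
    then have "b $ i < A $ i \<bullet> z0" if "i \<notin> S" for i
      using that by (auto simp: less_eq_vec_def matrix_mult_dot S_def active_set_def z0_def less_le)
    then show ?thesis
      using l0_pos by (simp add: U_def z_def l_def)
  qed
  have zU: "zstar \<gamma> A b y = z y" if y: "y \<in> U" for y
  proof (rule zstar_eqI_kkt[OF g _ _ stat _ bd])
    have "b $ i \<le> A $ i \<bullet> z y" for i
      using y act[of i y] by (cases "i \<in> S") (auto simp: U_def dest: spec[of _ i])
    then show "b \<le> A *v z y"
      by (simp add: less_eq_vec_def matrix_mult_dot)
    have "0 \<le> l y $ i" for i
      using y l_out[of i y] by (cases "i \<in> S") (auto simp: U_def dest: spec[of _ i])
    then show "0 \<le> l y"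
      by (simp add: less_eq_vec_def)
    show "l y $ i * (A $ i \<bullet> z y - b $ i) = 0" for i
      by (cases "i \<in> S") (simp_all add: act l_out)
  qed
  have "active_set \<gamma> A b y = S" if y: "y \<in> U" for y
  proof -
    have "A $ i \<bullet> z y = b $ i \<longleftrightarrow> i \<in> S" for i
      using y act[of i y] by (cases "i \<in> S") (auto simp: U_def dest: spec[of _ i])
    then show ?thesis by (simp add: active_set_def zU[OF y])
  qed
  moreover have "zstar \<gamma> A b y = M *v y + (z0 - M *v y0)" if "y \<in> U" for y
    using zU[OF that] by (simp add: z_def matrix_vector_mult_diff_distrib)
  \<comment> \<open>\<open>zstar\<close> agrees with the affine map \<open>z\<close> on an open set
    around \<open>y0\<close>, so it has the same derivative there.\<close>
  moreover have der: "(zstar \<gamma> A b has_derivative (\<lambda>v. M *v v)) (at y0)"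
  proof (rule has_derivative_transform_within_open[OF _ oU y0U])
    show "(z has_derivative (\<lambda>v. M *v v)) (at y0)"
      unfolding z_def
      by (auto intro!: derivative_eq_intros bounded_linear.has_derivative[OF matrix_vector_mul_bounded_linear])
  qed (simp add: zU)
  moreover have "jacobian (zstar \<gamma> A b) (at y0) = M"
    by (simp add: jacobian_def frechet_derivative_at[OF der, symmetric])
  ultimately show ?thesis
    using oU y0U unfolding differentiable_def M_def X_def by blast
qed

end
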